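(* Let $A$ be a pseudo $BL$-algebra and let $F$ be an interval valued $(\in,\in\!\vee q)$-fuzzy filter of $A$ such that $\widehat{\mu_F}(x\rightarrow y)=\widehat{\mu_F}(x\hookrightarrow y)$ for all $x,y\in A$. Then the following are equivalent: (1) $F$ is an interval valued $(\in,\in\!\vee q)$-fuzzy implicative filter of $A$; (2) $F$ is both an interval valued $(\in,\in\!\vee q)$-fuzzy $MV$-filter and an interval valued $(\in,\in\!\vee q)$-fuzzy $G$-filter of $A$.
   Context: A pseudo $BL$-algebra is an algebra $(A;\wedge,\vee,\odot,\rightarrow,\hookrightarrow,0,1)$ of type $(2,2,2,2,2,0,0)$ such that $(A,\wedge,\vee,0,1)$ is a bounded lattice with lattice order $\le$, $(A,\odot,1)$ is a monoid, and for all $x,y,z\in A$: (a1) $x\odot y\le z\iff x\le y\rightarrow z\iff y\le x\hookrightarrow z$; (a2) $x\wedge y=(x\rightarrow y)\odot x=x\odot(x\hookrightarrow y)$; (a3) $(x\rightarrow y)\vee(y\rightarrow x)=(x\hookrightarrow y)\vee(y\hookrightarrow x)=1$. An interval number is $\widehat{a}=[a^{\bot},a^{\top}]$ with $0\le a^{\bot}\le a^{\top}\le 1$; $D[0,1]$ is the set of interval numbers. $\widehat{a}\le\widehat{b}$ iff $a^{\bot}\le b^{\bot}$ and $a^{\top}\le b^{\top}$; $\widehat{a}<\widehat{b}$ iff $\widehat{a}\le\widehat{b}$ and $\widehat{a}\ne\widehat{b}$; $\mathrm{rmin},\mathrm{rmax}$ and sums are componentwise. An interval valued fuzzy set $F$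 of $A$ is a map $\widehat{\mu_F}:A\to D[0,1]$; standing assumption: for every $x\in A$, either $\widehat{\mu_F}(x)<[0.5,0.5]$ or $[0.5,0.5]\le\widehat{\mu_F}(x)$. For $x\in A$ and nonzero $\widehat t\in D[0,1]$: $U(x;\widehat t)\in F$ means $\widehat{\mu_F}(x)\ge\widehat t$; $U(x;\widehat t)\,q\,F$ means $\widehat{\mu_F}(x)+\widehat t>[1,1]$; $U(x;\widehat t)\in\!\vee q\,F$ means one of these holds. $F$ is an interval valued $(\in,\in\!\vee q)$-fuzzy filter if for all nonzero $\widehat t,\widehat r\in D[0,1]$ and $x,y\in A$: (F3) $U(x;\widehat t)\in F$ and $U(y;\widehat r)\in F$ imply $U(x\odot y;\mathrm{rmin}\{\widehat t,\widehat r\})\in\!\vee q\,F$; (F4) if $x\le y$ and $U(x;\widehat r)\in F$ then $U(y;\widehat r)\in\!\vee q\,F$. Such an $F$ is called, respectively: - an interval valued $(\in,\in\!\vee q)$-fuzzy implicative filter if for all $x,y$: $\widehat{\mu_F}(x)\ge\mathrm{rmin}\{\widehat{\mu_F}((x\rightarrow y)\hookrightarrow x),[0.5,0.5]\}$ and $\widehat{\mu_F}(x)\ge\mathrm{rmin}\{\widehat{\mu_F}((x\hookrightarrow y)\rightarrow x),[0.5,0.5]\}$; - an interval valued $(\in,\in\!\vee q)$-fuzzy $MV$-filter if for all $x,y$: $\widehat{\mu_F}(((y\rightarrow x)\hookrightarrow x)\rightarrow y)\ge\mathrm{rmin}\{\widehat{\mu_F}(x\rightarrow y),[0.5,0.5]\}$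 and $\widehat{\mu_F}(((y\hookrightarrow x)\rightarrow x)\hookrightarrow y)\ge\mathrm{rmin}\{\widehat{\mu_F}(x\hookrightarrow y),[0.5,0.5]\}$; - an interval valued $(\in,\in\!\vee q)$-fuzzy $G$-filter if for all $x,y$: $\widehat{\mu_F}(x\rightarrow y)\ge\mathrm{rmin}\{\widehat{\mu_F}(x\rightarrow(x\rightarrow y)),[0.5,0.5]\}$ and $\widehat{\mu_F}(x\hookrightarrow y)\ge\mathrm{rmin}\{\widehat{\mu_F}(x\hookrightarrow(x\hookrightarrow y)),[0.5,0.5]\}$. *)

theory Defs
  imports Complex_Main "HOL-Library.Product_Order" "HOL-Library.Product_Plus"
begin

text \<open>
  The lattice order and its bounds 0, 1 are those of \<^class>\<open>bounded_lattice\<close>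
  (\<^const>\<open>bot\<close>, \<^const>\<open>top\<close>). The first residual carries a subscript only to avoid a clash
  with the function space arrow of \<open>HOL-Library.FuncSet\<close>.
\<close>

class pseudo_bl_algebra = bounded_lattice +
  fixes odot :: "'a \<Rightarrow> 'a \<Rightarrow> 'a" (infixl \<open>\<odot>\<close> 70)
    and imp :: "'a \<Rightarrow> 'a \<Rightarrow> 'a" (infixr \<open>\<rightarrow>\<^sub>A\<close> 60)
    and imp' :: "'a \<Rightarrow> 'a \<Rightarrow> 'a" (infixr \<open>\<hookrightarrow>\<close> 60)
  assumes odot_assoc: "(x \<odot> y) \<odot> z = x \<odot> (y \<odot> z)"
    and top_odot: "top \<odot> x = x"
    and odot_top: "x \<odot> top = x"
    and odot_le_iff_imp: "x \<odot> y \<le> z \<longleftrightarrow> x \<le> y \<rightarrow>\<^sub>A z"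
    and odot_le_iff_imp': "x \<odot> y \<le> z \<longleftrightarrow> y \<le> x \<hookrightarrow> z"
    and inf_eq_imp: "inf x y = (x \<rightarrow>\<^sub>A y) \<odot> x"
    and inf_eq_imp': "inf x y = x \<odot> (x \<hookrightarrow> y)"
    and prelinear_imp: "sup (x \<rightarrow>\<^sub>A y) (y \<rightarrow>\<^sub>A x) = top"
    and prelinear_imp': "sup (x \<hookrightarrow> y) (y \<hookrightarrow> x) = top"

text \<open>
  An interval number is given by its pair of endpoints. On \<^typ>\<open>real \<times> real\<close> the order, \<^const>\<open>inf\<close>
  and addition are componentwise, so that \<open><\<close> is \<open>\<le>\<close> together with \<open>\<noteq>\<close>, and
  \<^const>\<open>inf\<close> is rmin. A sum of interval numbers need not be an interval number;
  it is only compared with \<open>[1,1]\<close>.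
\<close>

type_synonym ivnum = "real \<times> real"

definition D01 :: "ivnum set" where
  "D01 = {(a, b). 0 \<le> a \<and> a \<le> b \<and> b \<le> 1}"

abbreviation rmin :: "ivnum \<Rightarrow> ivnum \<Rightarrow> ivnum" where
  "rmin s t \<equiv> inf s t"

abbreviation half :: ivnum where
  "half \<equiv> (1/2, 1/2)"

definition iv_fuzzy_set :: "('a \<Rightarrow> ivnum) \<Rightarrow> bool" where
  "iv_fuzzy_set F \<longleftrightarrow> (\<forall>x. F x \<in> D01) \<and> (\<forall>x. F x < half \<or> half \<le> F x)"

definition U_in :: "'a \<Rightarrow> ivnum \<Rightarrow> ('a \<Rightarrow> ivnum) \<Rightarrow> bool" where
  "U_in x t F \<longleftrightarrow> t \<le> F x"

definition U_q :: "'a \<Rightarrow> ivnum \<Rightarrow> ('a \<Rightarrow> ivnum) \<Rightarrow> bool" where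
  "U_q x t F \<longleftrightarrow> (1, 1) < F x + t"

definition U_in_or_q :: "'a \<Rightarrow> ivnum \<Rightarrow> ('a \<Rightarrow> ivnum) \<Rightarrow> bool" where
  "U_in_or_q x t F \<longleftrightarrow> U_in x t F \<or> U_q x t F"

definition iv_fuzzy_filter :: "('a::pseudo_bl_algebra \<Rightarrow> ivnum) \<Rightarrow> bool" where
  "iv_fuzzy_filter F \<longleftrightarrow> iv_fuzzy_set F \<and>
    (\<forall>t \<in> D01 - {(0, 0)}. \<forall>r \<in> D01 - {(0, 0)}. \<forall>x y.
        U_in x t F \<longrightarrow> U_in y r F \<longrightarrow> U_in_or_q (x \<odot> y) (rmin t r) F) \<and>
    (\<forall>r \<in> D01 - {(0, 0)}. \<forall>x y.
        x \<le> y \<longrightarrow> U_in x r F \<longrightarrow> U_in_or_q y r F)"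

definition iv_fuzzy_implicative_filter :: "('a::pseudo_bl_algebra \<Rightarrow> ivnum) \<Rightarrow> bool" where
  "iv_fuzzy_implicative_filter F \<longleftrightarrow> iv_fuzzy_filter F \<and>
    (\<forall>x y. F x \<ge> rmin (F ((x \<rightarrow>\<^sub>A y) \<hookrightarrow> x)) half \<and>
           F x \<ge> rmin (F ((x \<hookrightarrow> y) \<rightarrow>\<^sub>A x)) half)"

definition iv_fuzzy_MV_filter :: "('a::pseudo_bl_algebra \<Rightarrow> ivnum) \<Rightarrow> bool" where
  "iv_fuzzy_MV_filter F \<longleftrightarrow> iv_fuzzy_filter F \<and>
    (\<forall>x y. F (((y \<rightarrow>\<^sub>A x) \<hookrightarrow> x) \<rightarrow>\<^sub>A y) \<ge> rmin (F (x \<rightarrow>\<^sub>A y)) half \<and>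
           F (((y \<hookrightarrow> x) \<rightarrow>\<^sub>A x) \<hookrightarrow> y) \<ge> rmin (F (x \<hookrightarrow> y)) half)"

definition iv_fuzzy_G_filter :: "('a::pseudo_bl_algebra \<Rightarrow> ivnum) \<Rightarrow> bool" where
  "iv_fuzzy_G_filter F \<longleftrightarrow> iv_fuzzy_filter F \<and>
    (\<forall>x y. F (x \<rightarrow>\<^sub>A y) \<ge> rmin (F (x \<rightarrow>\<^sub>A (x \<rightarrow>\<^sub>A y))) half \<and>
           F (x \<hookrightarrow> y) \<ge> rmin (F (x \<hookrightarrow> (x \<hookrightarrow> y))) half)"

end

theory Submission
  imports Defs
begin

text \<open>
  For \<open>t \<le> [0.5,0.5]\<close> the level set \<open>{x. t \<le> F x}\<close> of a fuzzy filter is a crisp filter, and each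
  of the fuzzy conditions holds iff all these level sets satisfy its crisp analogue. For a crisp
  filter \<open>S\<close>, implicativity puts every \<open>x \<squnion> (x \<rightarrow> y)\<close> into \<open>S\<close>, which yields both other conditions.
  Conversely, if \<open>(x \<rightarrow> y) \<hookrightarrow> x \<in> S\<close>, the G-condition gives \<open>(x \<rightarrow> y) \<hookrightarrow> y \<in> S\<close>, the assumption on the
  two arrows gives \<open>y \<rightarrow> x \<in> S\<close>, and then the MV-condition gives \<open>((x \<rightarrow> y) \<hookrightarrow> y) \<rightarrow> x \<in> S\<close>, whence \<open>x \<in> S\<close>.
\<close>

section \<open>Residuation in pseudo BL-algebras and the crisp conditions\<close>

context pseudo_bl_algebra
begin

lemma imp_odot_le: "(x \<rightarrow>\<^sub>A y) \<odot> x \<le> y"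
  by (simp add: odot_le_iff_imp)

lemma odot_imp'_le: "x \<odot> (x \<hookrightarrow> y) \<le> y"
  by (simp add: odot_le_iff_imp')

lemma le_imp_imp': "x \<le> (x \<rightarrow>\<^sub>A y) \<hookrightarrow> y"
  using imp_odot_le odot_le_iff_imp' by blast

lemma le_imp'_imp: "x \<le> (x \<hookrightarrow> y) \<rightarrow>\<^sub>A y"
  using odot_imp'_le odot_le_iff_imp by blast

lemma odot_right_mono: "x \<le> y \<Longrightarrow> x \<odot> z \<le> y \<odot> z"
  by (meson odot_le_iff_imp order_refl order_trans)

lemma odot_left_mono: "x \<le> y \<Longrightarrow> z \<odot> x \<le> z \<odot> y"
  by (meson odot_le_iff_imp' order_refl order_trans)

lemma imp_mono: "x' \<le> x \<Longrightarrow> y \<le> y' \<Longrightarrow> x \<rightarrow>\<^sub>A y \<le> x' \<rightarrow>\<^sub>A y'"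
  by (meson odot_le_iff_imp odot_left_mono imp_odot_le order_trans)

lemma imp'_mono: "x' \<le> x \<Longrightarrow> y \<le> y' \<Longrightarrow> x \<hookrightarrow> y \<le> x' \<hookrightarrow> y'"
  by (meson odot_le_iff_imp' odot_right_mono odot_imp'_le order_trans)

lemma le_imp: "y \<le> x \<rightarrow>\<^sub>A y"
  by (metis odot_le_iff_imp odot_left_mono odot_top top_greatest)

lemma le_imp': "y \<le> x \<hookrightarrow> y"
  by (metis odot_le_iff_imp' odot_right_mono top_odot top_greatest)

lemma imp_eq_top_iff: "x \<rightarrow>\<^sub>A y = top \<longleftrightarrow> x \<le> y"
  by (metis odot_le_iff_imp top_odot top_unique)

lemma imp'_eq_top_iff: "x \<hookrightarrow> y = top \<longleftrightarrow> x \<le> y"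
  by (metis odot_le_iff_imp' odot_top top_unique)

lemma imp_imp: "x \<rightarrow>\<^sub>A (y \<rightarrow>\<^sub>A z) = (x \<odot> y) \<rightarrow>\<^sub>A z"
  by (rule order.antisym) (metis odot_le_iff_imp odot_assoc order_refl)+

text \<open>The factors swap: \<open>w\<close> is below the left side iff
  \<open>y \<odot> (x \<odot> w) \<le> z\<close>.\<close>

lemma imp'_imp': "x \<hookrightarrow> (y \<hookrightarrow> z) = (y \<odot> x) \<hookrightarrow> z"
  by (rule order.antisym) (metis odot_le_iff_imp' odot_assoc order_refl)+

text \<open>Residuating on both sides turns the goal into \<open>sup y x \<le> (x
  \<rightarrow>\<^sub>A z) \<hookrightarrow> z\<close>, which can be checked on \<open>y\<close> and
  \<open>x\<close> separately.\<close>

lemma le_sup_imp: "y \<le> z \<Longrightarrow> x \<rightarrow>\<^sub>A z \<le> sup y x \<rightarrow>\<^sub>A z"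
  unfolding odot_le_iff_imp[symmetric] odot_le_iff_imp'
  by (intro le_supI le_imp_imp') (rule order_trans[OF _ le_imp'])

lemma le_sup_imp': "y \<le> z \<Longrightarrow> x \<hookrightarrow> z \<le> sup y x \<hookrightarrow> z"
  unfolding odot_le_iff_imp'[symmetric] odot_le_iff_imp
  by (intro le_supI le_imp'_imp) (rule order_trans[OF _ le_imp])

text \<open>Peirce's law as a rule, with membership in \<open>S\<close> read as truth.\<close>

definition implicative_set :: "'a set \<Rightarrow> bool" where
  "implicative_set S \<longleftrightarrow>
    (\<forall>x y. ((x \<rightarrow>\<^sub>A y) \<hookrightarrow> x \<in> S \<longrightarrow> x \<in> S) \<and> ((x \<hookrightarrow> y) \<rightarrow>\<^sub>A x \<in> S \<longrightarrow> x \<in> S))"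

text \<open>A double negation law relative to \<open>x\<close>: for \<open>S = {top}\<close> the
  first clause says that \<open>(y \<rightarrow>\<^sub>A x) \<hookrightarrow> x = y\<close> whenever
  \<open>x \<le> y\<close>.\<close>

definition MV_set :: "'a set \<Rightarrow> bool" where
  "MV_set S \<longleftrightarrow>
    (\<forall>x y. (x \<rightarrow>\<^sub>A y \<in> S \<longrightarrow> ((y \<rightarrow>\<^sub>A x) \<hookrightarrow> x) \<rightarrow>\<^sub>A y \<in> S) \<and>
           (x \<hookrightarrow> y \<in> S \<longrightarrow> ((y \<hookrightarrow> x) \<rightarrow>\<^sub>A x) \<hookrightarrow> y \<in> S))"

text \<open>The contraction rule; for \<open>S = {top}\<close> it makes \<open>\<odot>\<close>
  idempotent.\<close>

definition G_set :: "'a set \<Rightarrow> bool" where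
  "G_set S \<longleftrightarrow>
    (\<forall>x y. (x \<rightarrow>\<^sub>A (x \<rightarrow>\<^sub>A y) \<in> S \<longrightarrow> x \<rightarrow>\<^sub>A y \<in> S) \<and>
           (x \<hookrightarrow> (x \<hookrightarrow> y) \<in> S \<longrightarrow> x \<hookrightarrow> y \<in> S))"

end

section \<open>Crisp filters\<close>

text \<open>The empty set is allowed, since a level set may be empty.\<close>

locale pseudo_bl_filter =
  fixes S :: "'a::pseudo_bl_algebra set"
  assumes upward: "x \<in> S \<Longrightarrow> x \<le> y \<Longrightarrow> y \<in> S"
    and odot_closed: "x \<in> S \<Longrightarrow> y \<in> S \<Longrightarrow> x \<odot> y \<in> S"
begin

lemma imp_mp: "x \<rightarrow>\<^sub>A y \<in> S \<Longrightarrow> x \<in> S \<Longrightarrow> y \<in> S"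
  using imp_odot_le odot_closed upward by blast

lemma imp'_mp: "x \<hookrightarrow> y \<in> S \<Longrightarrow> x \<in> S \<Longrightarrow> y \<in> S"
  using odot_imp'_le odot_closed upward by blast

lemma top_in: "x \<in> S \<Longrightarrow> top \<in> S"
  using upward top_greatest by blast

text \<open>An excluded middle relative to \<open>y\<close>: for the join \<open>u\<close>,
  antitonicity gives \<open>u \<rightarrow>\<^sub>A y \<le> x \<rightarrow>\<^sub>A y \<le>
  u\<close>, so the premise of implicativity at \<open>u\<close> and \<open>y\<close> is
  \<open>top\<close>.\<close>

lemma sup_imp_in:
  assumes "implicative_set S" and "top \<in> S"
  shows "sup x (x \<rightarrow>\<^sub>A y) \<in> S"
proof -
  let ?u = "sup x (x \<rightarrow>\<^sub>A y)"
  have "?u \<rightarrow>\<^sub>A y \<le> ?u"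
    by (meson imp_mono order_refl order_trans sup_ge1 sup_ge2)
  then have "(?u \<rightarrow>\<^sub>A y) \<hookrightarrow> ?u \<in> S"
    using assms(2) by (metis imp'_eq_top_iff)
  then show ?thesis
    using assms(1) implicative_set_def by blast
qed

lemma sup_imp'_in:
  assumes "implicative_set S" and "top \<in> S"
  shows "sup x (x \<hookrightarrow> y) \<in> S"
proof -
  let ?u = "sup x (x \<hookrightarrow> y)"
  have "?u \<hookrightarrow> y \<le> ?u"
    by (meson imp'_mono order_refl order_trans sup_ge1 sup_ge2)
  then have "(?u \<hookrightarrow> y) \<rightarrow>\<^sub>A ?u \<in> S"
    using assms(2) by (metis imp_eq_top_iff)
  then show ?thesis
    using assms(1) implicative_set_def by blast
qed

text \<open>Proof by cases on the join of \<open>x\<close> and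
  \<open>x \<rightarrow>\<^sub>A y\<close>, which lies in \<open>S\<close>: both cases lead to
  \<open>z\<close>, the first by order, the second modulo \<open>S\<close>.\<close>

lemma implicative_imp_cases:
  assumes "implicative_set S" and "x \<le> z" and "(x \<rightarrow>\<^sub>A y) \<rightarrow>\<^sub>A z \<in> S"
  shows "z \<in> S"
proof (rule imp_mp)
  show "sup x (x \<rightarrow>\<^sub>A y) \<rightarrow>\<^sub>A z \<in> S"
    using assms(3) le_sup_imp[OF assms(2)] by (rule upward)
  show "sup x (x \<rightarrow>\<^sub>A y) \<in> S"
    using assms(1) top_in[OF assms(3)] by (rule sup_imp_in)
qed

lemma implicative_imp'_cases:
  assumes "implicative_set S" and "x \<le> z" and "(x \<hookrightarrow> y) \<hookrightarrow> z \<in> S"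
  shows "z \<in> S"
proof (rule imp'_mp)
  show "sup x (x \<hookrightarrow> y) \<hookrightarrow> z \<in> S"
    using assms(3) le_sup_imp'[OF assms(2)] by (rule upward)
  show "sup x (x \<hookrightarrow> y) \<in> S"
    using assms(1) top_in[OF assms(3)] by (rule sup_imp'_in)
qed

text \<open>Again cases on the join, with the roles exchanged: \<open>x\<close> leads to
  \<open>?z\<close> by assumption, and the other case is \<open>?z\<close> itself.\<close>

lemma implicative_imp_G:
  assumes "implicative_set S"
  shows "G_set S"
  unfolding G_set_def
proof (intro allI conjI impI)
  fix x y :: 'a
  let ?z = "x \<rightarrow>\<^sub>A y"
  assume *: "x \<rightarrow>\<^sub>A ?z \<in> S"
  then have "sup ?z x \<rightarrow>\<^sub>A ?z \<in> S"
    using le_sup_imp[OF order_refl] by (rule upward)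
  moreover have "sup ?z x \<in> S"
    using sup_imp_in[OF assms top_in[OF *]] by (simp add: sup_commute)
  ultimately show "?z \<in> S" by (rule imp_mp)
next
  fix x y :: 'a
  let ?z = "x \<hookrightarrow> y"
  assume *: "x \<hookrightarrow> ?z \<in> S"
  then have "sup ?z x \<hookrightarrow> ?z \<in> S"
    using le_sup_imp'[OF order_refl] by (rule upward)
  moreover have "sup ?z x \<in> S"
    using sup_imp'_in[OF assms top_in[OF *]] by (simp add: sup_commute)
  ultimately show "?z \<in> S" by (rule imp'_mp)
qed

lemma implicative_imp_MV:
  assumes "implicative_set S"
  shows "MV_set S"
  unfolding MV_set_def
proof (intro allI conjI impI)
  fix x y :: 'a
  let ?z = "((y \<rightarrow>\<^sub>A x) \<hookrightarrow> x) \<rightarrow>\<^sub>A y"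
  assume "x \<rightarrow>\<^sub>A y \<in> S"
  \<comment> \<open>Uncurrying the right side gives the antecedent \<open>(y \<rightarrow>\<^sub>A
    x) \<odot> ((y \<rightarrow>\<^sub>A x) \<hookrightarrow> x)\<close>, which is below
    \<open>x\<close>. The cases are then \<open>y\<close> and
    \<open>y \<rightarrow>\<^sub>A x\<close>.\<close>
  moreover have "x \<rightarrow>\<^sub>A y \<le> (y \<rightarrow>\<^sub>A x) \<rightarrow>\<^sub>A ?z"
    unfolding imp_imp by (intro imp_mono odot_imp'_le order_refl)
  ultimately have "(y \<rightarrow>\<^sub>A x) \<rightarrow>\<^sub>A ?z \<in> S" by (rule upward)
  then show "?z \<in> S"
    by (rule implicative_imp_cases[OF assms le_imp])
next
  fix x y :: 'a
  let ?z = "((y \<hookrightarrow> x) \<rightarrow>\<^sub>A x) \<hookrightarrow> y"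
  assume "x \<hookrightarrow> y \<in> S"
  moreover have "x \<hookrightarrow> y \<le> (y \<hookrightarrow> x) \<hookrightarrow> ?z"
    unfolding imp'_imp' by (intro imp'_mono imp_odot_le order_refl)
  ultimately have "(y \<hookrightarrow> x) \<hookrightarrow> ?z \<in> S" by (rule upward)
  then show "?z \<in> S"
    by (rule implicative_imp'_cases[OF assms le_imp'])
qed

lemma MV_G_imp_implicative:
  assumes normal: "\<And>x y :: 'a. x \<rightarrow>\<^sub>A y \<in> S \<longleftrightarrow> x \<hookrightarrow> y \<in> S"
    and MV: "MV_set S" and G: "G_set S"
  shows "implicative_set S"
  unfolding implicative_set_def
proof (intro allI conjI impI)
  fix x y :: 'a
  assume *: "(x \<rightarrow>\<^sub>A y) \<hookrightarrow> x \<in> S"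
  \<comment> \<open>Weakening the consequent \<open>x\<close> repeats the antecedent, as contraction
    requires.\<close>
  then have "(x \<rightarrow>\<^sub>A y) \<hookrightarrow> ((x \<rightarrow>\<^sub>A y) \<hookrightarrow> y) \<in> S"
    using imp'_mono[OF order_refl le_imp_imp'] by (rule upward)
  then have "(x \<rightarrow>\<^sub>A y) \<hookrightarrow> y \<in> S"
    using G G_set_def by blast
  moreover have "y \<hookrightarrow> x \<in> S"
    using * imp'_mono[OF le_imp order_refl] by (rule upward)
  \<comment> \<open>The MV-condition with \<open>x\<close> and \<open>y\<close> exchanged asks for
    the other arrow from \<open>y\<close> to \<open>x\<close>; \<open>normal\<close> supplies
    it.\<close>
  then have "((x \<rightarrow>\<^sub>A y) \<hookrightarrow> y) \<rightarrow>\<^sub>A x \<in> S"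
    using MV normal MV_set_def by blast
  ultimately show "x \<in> S" using imp_mp by blast
next
  fix x y :: 'a
  assume *: "(x \<hookrightarrow> y) \<rightarrow>\<^sub>A x \<in> S"
  then have "(x \<hookrightarrow> y) \<rightarrow>\<^sub>A ((x \<hookrightarrow> y) \<rightarrow>\<^sub>A y) \<in> S"
    using imp_mono[OF order_refl le_imp'_imp] by (rule upward)
  then have "(x \<hookrightarrow> y) \<rightarrow>\<^sub>A y \<in> S"
    using G G_set_def by blast
  moreover have "y \<rightarrow>\<^sub>A x \<in> S"
    using * imp_mono[OF le_imp' order_refl] by (rule upward)
  then have "((x \<hookrightarrow> y) \<rightarrow>\<^sub>A y) \<hookrightarrow> x \<in> S"
    using MV normal MV_set_def by blast
  ultimately show "x \<in> S" using imp'_mp by blast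
qed

end

section \<open>Fuzzy filters and their level sets\<close>

text \<open>If \<open>F x + t\<close> exceeds \<open>(1, 1)\<close> and \<open>t \<le> half\<close>,
  then \<open>F x \<ge> half \<ge> t\<close>, so quasi-coincidence adds nothing at such
  levels.\<close>

lemma U_in_or_q_le_half:
  assumes "U_in_or_q x t F" and "t \<le> half"
  shows "t \<le> F x"
  using assms unfolding U_in_or_q_def U_in_def U_q_def
  by (cases t; cases "F x") (auto simp: less_le)

lemma inf_in_D01: "s \<in> D01 \<Longrightarrow> t \<in> D01 \<Longrightarrow> inf s t \<in> D01"
  by (auto simp: D01_def inf_min min_def)

lemma iv_fuzzy_filter_inf_half_le:
  fixes F :: "'a::pseudo_bl_algebra \<Rightarrow> ivnum"
  assumes "iv_fuzzy_filter F"
  shows iv_fuzzy_filter_mono: "x \<le> y \<Longrightarrow> inf (F x) half \<le> F y"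
    and iv_fuzzy_filter_odot: "inf (inf (F x) (F y)) half \<le> F (x \<odot> y)"
proof -
  have D: "F z \<in> D01" for z
    using assms by (simp add: iv_fuzzy_filter_def iv_fuzzy_set_def)
  have half: "half \<in> D01" by (simp add: D01_def)
  have nonneg: "(0, 0) \<le> F z" for z
    using D[of z] by (auto simp: D01_def)
  have odot: "U_in_or_q (u \<odot> v) (inf t r) F"
    if "t \<in> D01 - {(0, 0)}" "r \<in> D01 - {(0, 0)}" "U_in u t F" "U_in v r F" for t r u v
    using assms that unfolding iv_fuzzy_filter_def by simp
  have up: "U_in_or_q v r F"
    if "r \<in> D01 - {(0, 0)}" "u \<le> v" "U_in u r F" for r u v
    using assms that unfolding iv_fuzzy_filter_def by simp
  show "inf (F x) half \<le> F y" if "x \<le> y"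
  \<comment> \<open>Fuzzy points have nonzero level, so level zero is settled by
    nonnegativity.\<close>
  proof (cases "inf (F x) half = (0, 0)")
    case True
    then show ?thesis using nonneg by metis
  next
    case False
    then have "inf (F x) half \<in> D01 - {(0, 0)}" using inf_in_D01 D half by simp
    moreover have "U_in x (inf (F x) half) F" unfolding U_in_def by (rule inf_le1)
    ultimately have "U_in_or_q y (inf (F x) half) F"
      using up that by metis
    then show ?thesis by (rule U_in_or_q_le_half) (rule inf_le2)
  qed
  \<comment> \<open>Both points get this common level, so that the \<open>rmin\<close> of the two
    levels is \<open>?t\<close> again.\<close>
  let ?t = "inf (inf (F x) (F y)) half"
  show "?t \<le> F (x \<odot> y)"
  proof (cases "?t = (0, 0)")
    case True
    then show ?thesis using nonneg by metis
  next
    case False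
    then have "?t \<in> D01 - {(0, 0)}" using inf_in_D01 D half by simp
    moreover have "U_in x ?t F" "U_in y ?t F"
      unfolding U_in_def by (simp_all add: le_infI1)
    ultimately have "U_in_or_q (x \<odot> y) (inf ?t ?t) F"
      using odot by metis
    then have "U_in_or_q (x \<odot> y) ?t F" by (simp only: inf_idem)
    then show ?thesis by (rule U_in_or_q_le_half) (rule inf_le2)
  qed
qed

lemma pseudo_bl_filter_level:
  assumes "iv_fuzzy_filter F" and "t \<le> half"
  shows "pseudo_bl_filter {x. t \<le> F x}"
proof
  fix x y
  assume "x \<in> {x. t \<le> F x}"
  then have x: "t \<le> F x" by simp
  show "y \<in> {x. t \<le> F x}" if "x \<le> y"
    using order_trans[OF le_infI iv_fuzzy_filter_mono[OF assms(1) that]] x assms(2)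
    by simp
  show "x \<odot> y \<in> {x. t \<le> F x}" if "y \<in> {x. t \<le> F x}"
    using order_trans[OF le_infI[OF le_infI] iv_fuzzy_filter_odot[OF assms(1)]] x that assms(2)
    by simp
qed

text \<open>The memberships stay unsimplified so that the right side matches the crisp definitions
  at level sets.\<close>

lemma inf_half_le_iff_levels:
  fixes F :: "'a \<Rightarrow> ivnum"
  shows "inf (F a) half \<le> F b \<longleftrightarrow> (\<forall>t\<le>half. a \<in> {x. t \<le> F x} \<longrightarrow> b \<in> {x. t \<le> F x})"
proof
  assume "inf (F a) half \<le> F b"
  then have "t \<le> F b" if "t \<le> half" "t \<le> F a" for t
    using that by (meson le_infI order_trans)
  then show "\<forall>t\<le>half. a \<in> {x. t \<le> F x} \<longrightarrow> b \<in> {x. t \<le> F x}"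
    by simp
next
  assume "\<forall>t\<le>half. a \<in> {x. t \<le> F x} \<longrightarrow> b \<in> {x. t \<le> F x}"
  \<comment> \<open>The decisive level is \<open>t = inf (F a) half\<close>.\<close>
  from this[rule_format, OF inf_le2] show "inf (F a) half \<le> F b"
    by simp
qed

lemma iv_fuzzy_implicative_filter_iff_levels:
  "iv_fuzzy_implicative_filter F \<longleftrightarrow>
    iv_fuzzy_filter F \<and> (\<forall>t\<le>half. implicative_set {x. t \<le> F x})"
  unfolding iv_fuzzy_implicative_filter_def implicative_set_def inf_half_le_iff_levels by blast

lemma iv_fuzzy_MV_filter_iff_levels:
  "iv_fuzzy_MV_filter F \<longleftrightarrow> iv_fuzzy_filter F \<and> (\<forall>t\<le>half. MV_set {x. t \<le> F x})"
  unfolding iv_fuzzy_MV_filter_def MV_set_def inf_half_le_iff_levels by blast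

lemma iv_fuzzy_G_filter_iff_levels:
  "iv_fuzzy_G_filter F \<longleftrightarrow> iv_fuzzy_filter F \<and> (\<forall>t\<le>half. G_set {x. t \<le> F x})"
  unfolding iv_fuzzy_G_filter_def G_set_def inf_half_le_iff_levels by blast

theorem theorem4p10:
  fixes F :: "'a::pseudo_bl_algebra \<Rightarrow> ivnum"
  assumes "iv_fuzzy_filter F"
    and "\<And>x y. F (x \<rightarrow>\<^sub>A y) = F (x \<hookrightarrow> y)"
  shows "iv_fuzzy_implicative_filter F \<longleftrightarrow> iv_fuzzy_MV_filter F \<and> iv_fuzzy_G_filter F"
proof -
  have "implicative_set {x. t \<le> F x} \<longleftrightarrow> MV_set {x. t \<le> F x} \<and> G_set {x. t \<le> F x}"
    if "t \<le> half" for t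
  proof -
    interpret pseudo_bl_filter "{x. t \<le> F x}"
      using assms(1) that by (rule pseudo_bl_filter_level)
    show ?thesis
    proof
      assume "implicative_set {x. t \<le> F x}"
      then show "MV_set {x. t \<le> F x} \<and> G_set {x. t \<le> F x}"
        by (intro conjI implicative_imp_MV implicative_imp_G)
    next
      assume "MV_set {x. t \<le> F x} \<and> G_set {x. t \<le> F x}"
      then show "implicative_set {x. t \<le> F x}"
        by (intro MV_G_imp_implicative) (simp_all add: assms(2))
    qed
  qed
  then show ?thesis
    unfolding iv_fuzzy_implicative_filter_iff_levels iv_fuzzy_MV_filter_iff_levels
      iv_fuzzy_G_filter_iff_levels
    by blast
qed

end
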